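(* Let $\mathcal{S}=(a_{n,m})_{n,m\geq 0}$ be the infinite matrix of complex numbers determined by an initial column $(a_{n,0})_{n\geq0}$ via $a_{n,m+1}=a_{n+1,m}-m\,a_{n,m}$ for all $n,m\geq 0$. Fix $r\geq 0$ and let $\mathcal{B}_r(z)=\sum_{k\geq 0}a_{k+r,0}\frac{z^k}{k!}$ and $\mathcal{A}_r(z)=\sum_{m\geq 0}a_{r,m}\frac{z^m}{m!}$ (formal power series). Then $$\mathcal{A}_r(z)=\mathcal{B}_r\left(\ln(1+z)\right).$$ *)

theory Defs
  imports Complex_Main "HOL-Computational_Algebra.Formal_Power_Series"
begin

end

theory Submission
  imports Defs
begin

unbundle fps_syntax

text \<open>
  Since \<open>\<B>\<^sub>r' = \<B>\<^sub>r\<^sub>+\<^sub>1\<close>, the series \<open>C\<^sub>r(z) = \<B>\<^sub>r(ln (1 + z))\<close> satisfy \<open>(1 + z) C\<^sub>r'(z) = C\<^sub>r\<^sub>+\<^sub>1(z)\<close>.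
  Comparing coefficients, the numbers \<open>m! [z^m] C\<^sub>r\<close> obey the recurrence that defines \<open>a\<^sub>r\<^sub>,\<^sub>m\<close>, and both
  agree for \<open>m = 0\<close>.
\<close>

text \<open>By the chain rule: \<open>fps_ln 1\<close> is ln(1 + z), with derivative 1/(1 + z),
  which the factor \<open>1 + fps_X\<close> cancels.\<close>

lemma fps_deriv_compose_ln:
  fixes F :: "'a::field_char_0 fps"
  shows "(1 + fps_X) * fps_deriv (F oo fps_ln 1) = fps_deriv F oo fps_ln 1"
proof -
  have "(1 + fps_X) * inverse (1 + fps_X :: 'a fps) = 1"
    using inverse_mult_eq_1[of "1 + fps_X :: 'a fps"] by (simp add: mult.commute)
  then show ?thesis
    by (simp add: fps_compose_deriv fps_ln_deriv mult.left_commute)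
qed

lemma fps_nth_compose_ln_Suc:
  fixes F :: "'a::field_char_0 fps"
  shows "of_nat (Suc m) * (F oo fps_ln 1) $ Suc m
    = (fps_deriv F oo fps_ln 1) $ m - of_nat m * (F oo fps_ln 1) $ m"
proof -
  have "(fps_deriv F oo fps_ln 1) $ m = ((1 + fps_X) * fps_deriv (F oo fps_ln 1)) $ m"
    by (simp only: fps_deriv_compose_ln)
  also have "\<dots> = of_nat (Suc m) * (F oo fps_ln 1) $ Suc m + of_nat m * (F oo fps_ln 1) $ m"
    \<comment> \<open>Multiplication by \<open>fps_X\<close> shifts the index, so m = 0 is separate:
      there the second summand vanishes.\<close>
    by (cases m) (simp_all add: distrib_right)
  finally show ?thesis by simp
qed

theorem theorem4:
  fixes a :: "nat \<Rightarrow> nat \<Rightarrow> complex" and r :: nat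
  assumes "\<And>n m. a n (m + 1) = a (n + 1) m - of_nat m * a n m"
  shows "Abs_fps (\<lambda>m. a r m / fact m) = fps_compose (Abs_fps (\<lambda>k. a (k + r) 0 / fact k)) (fps_ln 1)"
proof -
  define B where "B n = Abs_fps (\<lambda>k. a (k + n) 0 / fact k)" for n
  have deriv_B: "fps_deriv (B n) = B (Suc n)" for n
    by (simp add: B_def fps_eq_iff field_simps del: of_nat_Suc)
  \<comment> \<open>All rows are treated at once, since column m + 1 of row n involves row n +
    1.\<close>
  have "a n m = fact m * (B n oo fps_ln 1) $ m" for n m
  proof (induction m arbitrary: n)
    case 0
    show ?case by (simp add: B_def)
  next
    case (Suc m)
    have "fact (Suc m) * (B n oo fps_ln 1) $ Suc m
      = fact m * (of_nat (Suc m) * (B n oo fps_ln 1) $ Suc m)"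
      by (simp add: algebra_simps)
    also have "\<dots> = fact m * (B (Suc n) oo fps_ln 1) $ m - of_nat m * (fact m * (B n oo fps_ln 1) $ m)"
      by (simp only: fps_nth_compose_ln_Suc deriv_B right_diff_distrib mult.left_commute)
    also have "\<dots> = a (Suc n) m - of_nat m * a n m"
      by (simp only: Suc.IH)
    also have "\<dots> = a n (Suc m)"
      using assms[of n m] by simp
    finally show ?case ..
  qed
  then have "a r m / fact m = (B r oo fps_ln 1) $ m" for m
    by (metis fact_nonzero nonzero_mult_div_cancel_left)
  then show ?thesis
    by (simp only: fps_eq_iff fps_nth_Abs_fps flip: B_def) simp
qed

end
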